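(* The collection of functions $\{f_\beta:\beta\in\mathbb{Q}/\mathbb{Z}\}$ is a complete orthonormal basis of $L^2(\mathbb{R}/\mathbb{Z})$, where $\mathbb{R}/\mathbb{Z}$ carries normalized Haar measure.
   Context: Every $\beta\in\mathbb{Q}/\mathbb{Z}$ can be written $\beta=a/q$ with $q\ge1$ and $\gcd(a,q)=1$; its height is $h(\beta)=q$. For $Q\ge1$ put $\mathcal{F}_Q=\{\beta:h(\beta)\le Q\}$. For distinct $a,b\in\mathbb{R}/\mathbb{Z}$, $I(a,b)=\{a+t\bmod1:0<t<d\}$ with $d\in(0,1)$, $d\equiv b-a\pmod 1$, is the open arc from $a$ to $b$ in the positive direction. $\overline{I}(a,b)$ is its closure. For $\beta\neq0$ with $h(\beta)=Q$: $\beta'$ is the unique point of $\mathcal{F}_Q$ with $I(\beta',\beta)\cap\mathcal{F}_Q=\emptyset$, and $\beta''$ is the unique point of $\mathcal{F}_Q$ with $I(\beta,\beta'')\cap\mathcal{F}_Q=\emptyset$. Let $\psi(x)=x-[x]-\tfrac12$ for $x\notin\mathbb{Z}$ and $\psi(x)=0$ for $x\in\mathbb{Z}$. Define $f_0\equiv1$ and, for $\beta\ne0$, $$f_\beta(x)=h(\beta)\psi(x-\beta)-h(\beta')\psi(x-\beta')-h(\beta'')\psi(x-\beta'').$$ *)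

theory Defs
  imports "HOL-Analysis.Analysis"
begin

quotient_type circle = real / "\<lambda>x y::real. x - y \<in> \<int>"
  morphisms rep_circle to_circle
proof (rule equivpI)
  show "reflp (\<lambda>x y::real. x - y \<in> \<int>)"
    by (simp add: reflp_def)
  show "symp (\<lambda>x y::real. x - y \<in> \<int>)"
    by (rule sympI) (metis Ints_minus minus_diff_eq)
  show "transp (\<lambda>x y::real. x - y \<in> \<int>)"
  proof (rule transpI)
    fix x y z :: real
    assume "x - y \<in> \<int>" "y - z \<in> \<int>"
    then have "(x - y) + (y - z) \<in> \<int>" by (rule Ints_add)
    then show "x - z \<in> \<int>" by simp
  qed
qed

instantiation circle :: ab_group_add
begin

lift_definition zero_circle :: circle is "0 :: real" .

lift_definition plus_circle :: "circle \<Rightarrow> circle \<Rightarrow> circle" is "(+) :: real \<Rightarrow> real \<Rightarrow> real"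
proof -
  fix a b c d :: real
  assume "a - b \<in> \<int>" "c - d \<in> \<int>"
  then have "(a - b) + (c - d) \<in> \<int>" by (rule Ints_add)
  then show "(a + c) - (b + d) \<in> \<int>" by (simp add: algebra_simps)
qed

lift_definition uminus_circle :: "circle \<Rightarrow> circle" is "uminus :: real \<Rightarrow> real"
proof -
  fix a b :: real
  assume "a - b \<in> \<int>"
  then have "- (a - b) \<in> \<int>" by (rule Ints_minus)
  then show "- a - - b \<in> \<int>" by simp
qed

lift_definition minus_circle :: "circle \<Rightarrow> circle \<Rightarrow> circle" is "(-) :: real \<Rightarrow> real \<Rightarrow> real"
proof -
  fix a b c d :: real
  assume "a - b \<in> \<int>" "c - d \<in> \<int>"
  then have "(a - b) - (c - d) \<in> \<int>" by (rule Ints_diff)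
  then show "(a - c) - (b - d) \<in> \<int>" by (simp add: algebra_simps)
qed

instance
  by standard (transfer; simp)+

end

text \<open>The quotient topology, so that \<open>borel\<close> is the Borel \<open>\<sigma>\<close>-algebra of \<open>\<real>/\<int>\<close>.\<close>

instantiation circle :: topological_space
begin

definition open_circle :: "circle set \<Rightarrow> bool" where
  "open_circle U \<longleftrightarrow> open (to_circle -` U)"

instance
  by standard (auto simp: open_circle_def vimage_Int vimage_Union)

end

text \<open>Normalized Haar measure, computed on the fundamental domain \<open>[0,1)\<close>.\<close>

definition haar_circle :: "circle measure" where
  "haar_circle = distr (restrict_space lborel {0..<1}) borel to_circle"

lemma to_circle_measurable [measurable]: "to_circle \<in> borel_measurable borel"
  by (rule borel_measurable_continuous_onI)
     (simp add: continuous_on_open_vimage open_circle_def)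

lemma to_circle_eq_iff: "to_circle x = to_circle y \<longleftrightarrow> x - y \<in> \<int>"
  by (rule circle.abs_eq_iff)

lemma to_circle_measurable_fundamental:
  "to_circle \<in> restrict_space lborel {0..<1} \<rightarrow>\<^sub>M borel"
  by (rule measurable_restrict_space1) simp

lemma prob_haar_circle: "emeasure haar_circle (space haar_circle) = 1"
  unfolding haar_circle_def
  by (subst emeasure_distr[OF to_circle_measurable_fundamental])
     (auto simp: emeasure_restrict_space space_restrict_space)

definition rational_circle :: "circle set" where
  "rational_circle = to_circle ` \<rat>"

definition height :: "circle \<Rightarrow> nat" where
  "height \<beta> = (THE q. q \<ge> 1 \<and>
     (\<exists>a::int. coprime a (int q) \<and> \<beta> = to_circle (of_int a / of_nat q)))"

lemma height_eq:
  assumes "q \<ge> 1" "coprime a (int q)"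
  shows "height (to_circle (of_int a / of_nat q)) = q"
  unfolding height_def
proof (rule the_equality)
  show "q \<ge> 1 \<and> (\<exists>b. coprime b (int q) \<and>
      to_circle (of_int a / of_nat q) = to_circle (of_int b / of_nat q))"
    using assms by blast
next
  fix r
  assume r: "r \<ge> 1 \<and> (\<exists>b. coprime b (int r) \<and>
      to_circle (of_int a / of_nat q) = to_circle (of_int b / of_nat r))"
  then obtain b where b: "coprime b (int r)"
      "real_of_int a / real q - real_of_int b / real r \<in> \<int>"
    by (auto simp: to_circle_eq_iff)
  then obtain n where "real_of_int a / real q - real_of_int b / real r = real_of_int n"
    by (auto elim: Ints_cases)
  with assms(1) r have "real_of_int (a * int r) = real_of_int (b * int q + n * int q * int r)"
    by (simp add: field_simps)
  then have eq: "a * int r = b * int q + n * int q * int r"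
    by (simp only: of_int_eq_iff)
  then have "a * int r = int q * (b + n * int r)" "b * int q = int r * (a - n * int q)"
    by (simp_all add: algebra_simps)
  then have "int q dvd a * int r" "int r dvd b * int q"
    by (metis dvd_triv_left)+
  with assms(2) b(1) have "int q dvd int r" "int r dvd int q"
    by (simp_all add: coprime_dvd_mult_right_iff coprime_commute)
  then show "r = q"
    by (simp add: dvd_antisym)
qed

definition farey :: "nat \<Rightarrow> circle set" where
  "farey Q = {\<beta> \<in> rational_circle. height \<beta> \<le> Q}"

text \<open>For \<open>a \<noteq> b\<close> the number \<open>d\<close> is unique; for \<open>a = b\<close> there is none, and the set is
  empty. Hence the explicit \<open>\<gamma> \<noteq> \<beta>\<close> in the definitions of the neighbours below.\<close>

definition circle_arc :: "circle \<Rightarrow> circle \<Rightarrow> circle set" where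
  "circle_arc a b = {a + to_circle t | t d. 0 < t \<and> t < d \<and> d < 1 \<and> to_circle d = b - a}"

definition left_nbr :: "circle \<Rightarrow> circle" where
  "left_nbr \<beta> = (THE \<gamma>. \<gamma> \<in> farey (height \<beta>) \<and> \<gamma> \<noteq> \<beta> \<and> circle_arc \<gamma> \<beta> \<inter> farey (height \<beta>) = {})"

definition right_nbr :: "circle \<Rightarrow> circle" where
  "right_nbr \<beta> = (THE \<gamma>. \<gamma> \<in> farey (height \<beta>) \<and> \<gamma> \<noteq> \<beta> \<and> circle_arc \<beta> \<gamma> \<inter> farey (height \<beta>) = {})"

lift_definition psi :: "circle \<Rightarrow> real" is
  "\<lambda>x::real. if x \<in> \<int> then 0 else x - of_int \<lfloor>x\<rfloor> - 1 / 2"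
proof -
  fix x y :: real
  assume "x - y \<in> \<int>"
  then obtain n where "x - y = of_int n" by (auto elim: Ints_cases)
  then have "x = y + of_int n" by simp
  then show "(if x \<in> \<int> then 0 else x - of_int \<lfloor>x\<rfloor> - 1 / 2) =
      (if y \<in> \<int> then 0 else y - of_int \<lfloor>y\<rfloor> - 1 / 2)"
    by simp
qed

definition farey_fun :: "circle \<Rightarrow> circle \<Rightarrow> real" where
  "farey_fun \<beta> x =
     (if \<beta> = 0 then 1
      else real (height \<beta>) * psi (x - \<beta>)
         - real (height (left_nbr \<beta>)) * psi (x - left_nbr \<beta>)
         - real (height (right_nbr \<beta>)) * psi (x - right_nbr \<beta>))"

text \<open>Elements of \<open>L\<^sup>2\<close> are represented by functions; functions that agree almost everywhere are
  at \<open>L2_norm\<close>-distance 0.\<close>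

definition L2 :: "'a measure \<Rightarrow> ('a \<Rightarrow> complex) set" where
  "L2 M = {f \<in> borel_measurable M. integrable M (\<lambda>x. (cmod (f x))\<^sup>2)}"

definition L2_inner :: "'a measure \<Rightarrow> ('a \<Rightarrow> complex) \<Rightarrow> ('a \<Rightarrow> complex) \<Rightarrow> complex" where
  "L2_inner M f g = (LINT x|M. f x * cnj (g x))"

definition L2_norm :: "'a measure \<Rightarrow> ('a \<Rightarrow> complex) \<Rightarrow> real" where
  "L2_norm M f = sqrt (LINT x|M. (cmod (f x))\<^sup>2)"

definition L2_orthonormal :: "'a measure \<Rightarrow> 'i set \<Rightarrow> ('i \<Rightarrow> 'a \<Rightarrow> complex) \<Rightarrow> bool" where
  "L2_orthonormal M I e \<longleftrightarrow>
     (\<forall>i\<in>I. e i \<in> L2 M) \<and>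
     (\<forall>i\<in>I. \<forall>j\<in>I. L2_inner M (e i) (e j) = (if i = j then 1 else 0))"

text \<open>Completeness: the linear span of the family is dense.\<close>

definition L2_orthonormal_basis :: "'a measure \<Rightarrow> 'i set \<Rightarrow> ('i \<Rightarrow> 'a \<Rightarrow> complex) \<Rightarrow> bool" where
  "L2_orthonormal_basis M I e \<longleftrightarrow>
     L2_orthonormal M I e \<and>
     (\<forall>g\<in>L2 M. \<forall>\<epsilon>>0. \<exists>F c. finite F \<and> F \<subseteq> I \<and>
        L2_norm M (\<lambda>x. g x - (\<Sum>i\<in>F. c i * e i x)) < \<epsilon>)"

end

theory Submission imports Defs begin

text \<open>If \<open>\<beta> = a/q\<close> has neighbours \<open>\<beta>' = a'/q'\<close> and \<open>\<beta>'' = a''/q''\<close>, then \<open>q = q' + q''\<close>, so the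
  linear parts in \<open>f\<^sub>\<beta>\<close> cancel: \<open>f\<^sub>\<beta>\<close> equals \<open>q'\<close> on \<open>(\<beta>', \<beta>)\<close>, equals \<open>- q''\<close> on
  \<open>(\<beta>, \<beta>'')\<close>, and vanishes elsewhere. These arcs have lengths \<open>1/(q q')\<close> and \<open>1/(q q'')\<close>, whence
  mean 0 and norm 1. If \<open>h(\<beta>) \<le> h(\<gamma>)\<close> and \<open>\<beta> \<noteq> \<gamma>\<close>, then \<open>f\<^sub>\<beta>\<close> has no jump in the support of \<open>f\<^sub>\<gamma>\<close>,
  which gives orthogonality. By induction on the height, the span contains the indicator of \<open>[0, c)\<close>
  for every rational \<open>c\<close>, and a Dynkin argument yields density.\<close>

section \<open>Closed spans in \<open>L\<^sup>2\<close>\<close>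

lemma L2_borel: "f \<in> L2 M \<Longrightarrow> f \<in> borel_measurable M"
  by (simp add: L2_def)

lemma L2_integrable: "f \<in> L2 M \<Longrightarrow> integrable M (\<lambda>x. (cmod (f x))\<^sup>2)"
  by (simp add: L2_def)

lemma L2I_dominated:
  assumes "f \<in> borel_measurable M" "integrable M w" "AE x in M. (cmod (f x))\<^sup>2 \<le> w x"
  shows "f \<in> L2 M"
  unfolding L2_def using assms
  by (auto intro!: Bochner_Integration.integrable_bound[OF assms(2)])

lemma norm_add_squared_le: "(cmod (u + v))\<^sup>2 \<le> 2 * (cmod u)\<^sup>2 + 2 * (cmod v)\<^sup>2"
proof -
  have "(cmod (u + v))\<^sup>2 \<le> (cmod u + cmod v)\<^sup>2"
    by (intro power_mono norm_triangle_ineq) auto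
  also have "\<dots> \<le> 2 * (cmod u)\<^sup>2 + 2 * (cmod v)\<^sup>2"
    using sum_squares_bound[of "cmod u" "cmod v"] by (simp add: power2_sum)
  finally show ?thesis .
qed

lemma L2_add:
  assumes "f \<in> L2 M" "g \<in> L2 M"
  shows "(\<lambda>x. f x + g x) \<in> L2 M"
proof (rule L2I_dominated)
  show "(\<lambda>x. f x + g x) \<in> borel_measurable M"
    using assms[THEN L2_borel] by measurable
  show "integrable M (\<lambda>x. 2 * (cmod (f x))\<^sup>2 + 2 * (cmod (g x))\<^sup>2)"
    using assms[THEN L2_integrable] by auto
qed (auto intro: norm_add_squared_le)

lemma L2_scale:
  assumes "f \<in> L2 M"
  shows "(\<lambda>x. k * f x) \<in> L2 M"
  using assms by (auto simp: L2_def norm_mult power_mult_distrib)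

lemma L2_diff:
  assumes "f \<in> L2 M" "g \<in> L2 M"
  shows "(\<lambda>x. f x - g x) \<in> L2 M"
  using L2_add[OF assms(1) L2_scale[OF assms(2), of "-1"]] by simp

lemma L2_sum:
  assumes "\<And>i. i \<in> F \<Longrightarrow> f i \<in> L2 M"
  shows "(\<lambda>x. \<Sum>i\<in>F. f i x) \<in> L2 M"
  using assms
proof (induction F rule: infinite_finite_induct)
  case (insert i F)
  then show ?case by (simp add: L2_add)
qed (auto simp: L2_def)

text \<open>A substitute for the triangle inequality that works with squared norms. It doubles each
  error, so two errors below \<open>\<epsilon> / 4\<close> combine to one below
  \<open>\<epsilon>\<close>.\<close>

lemma integral_norm_add_squared_le:
  assumes "f \<in> L2 M" "g \<in> L2 M"
  shows "(LINT x|M. (cmod (f x + g x))\<^sup>2)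
    \<le> 2 * (LINT x|M. (cmod (f x))\<^sup>2) + 2 * (LINT x|M. (cmod (g x))\<^sup>2)"
proof -
  have "(LINT x|M. (cmod (f x + g x))\<^sup>2) \<le> (LINT x|M. 2 * (cmod (f x))\<^sup>2 + 2 * (cmod (g x))\<^sup>2)"
    using assms[THEN L2_integrable] L2_integrable[OF L2_add[OF assms]]
    by (intro integral_mono norm_add_squared_le) auto
  also have "\<dots> = 2 * (LINT x|M. (cmod (f x))\<^sup>2) + 2 * (LINT x|M. (cmod (g x))\<^sup>2)"
    using assms[THEN L2_integrable] by simp
  finally show ?thesis .
qed

text \<open>The error is a squared norm, which keeps square roots out of all closure arguments; the
  final theorem recovers \<open>L2_norm\<close> by asking for the error
  \<open>\<epsilon>\<^sup>2\<close>.\<close>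

definition L2_closed_span :: "'a measure \<Rightarrow> 'i set \<Rightarrow> ('i \<Rightarrow> 'a \<Rightarrow> complex) \<Rightarrow> ('a \<Rightarrow> complex) set" where
  "L2_closed_span M I e = {g \<in> L2 M. \<forall>\<epsilon>>0. \<exists>F c. finite F \<and> F \<subseteq> I \<and>
     (LINT x|M. (cmod (g x - (\<Sum>i\<in>F. c i * e i x)))\<^sup>2) < \<epsilon>}"

section \<open>Closure properties of the closed span\<close>

locale L2_family =
  fixes M :: "'a measure" and I :: "'i set" and e :: "'i \<Rightarrow> 'a \<Rightarrow> complex"
  assumes family_L2: "i \<in> I \<Longrightarrow> e i \<in> L2 M"
begin

lemma span_L2:
  assumes "F \<subseteq> I"
  shows "(\<lambda>x. \<Sum>i\<in>F. c i * e i x) \<in> L2 M"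
  using assms family_L2 by (intro L2_sum L2_scale) auto

lemma closed_spanD:
  assumes "g \<in> L2_closed_span M I e" "\<epsilon> > 0"
  obtains F c where "finite F" "F \<subseteq> I" "(LINT x|M. (cmod (g x - (\<Sum>i\<in>F. c i * e i x)))\<^sup>2) < \<epsilon>"
  using assms unfolding L2_closed_span_def by blast

lemma closed_span_L2: "g \<in> L2_closed_span M I e \<Longrightarrow> g \<in> L2 M"
  by (simp add: L2_closed_span_def)

lemma closed_span_zero: "(\<lambda>x. 0) \<in> L2_closed_span M I e"
proof -
  have "(\<lambda>x. 0) \<in> L2 M" by (simp add: L2_def)
  then show ?thesis
    unfolding L2_closed_span_def by (auto intro!: exI[of _ "{}"])
qed

lemma closed_span_member:
  assumes "i \<in> I"
  shows "e i \<in> L2_closed_span M I e"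
  unfolding L2_closed_span_def using assms family_L2
  by (auto intro!: exI[of _ "{i}"] exI[of _ "\<lambda>_. 1"])

lemma closed_span_add:
  assumes f: "f \<in> L2_closed_span M I e" and g: "g \<in> L2_closed_span M I e"
  shows "(\<lambda>x. f x + g x) \<in> L2_closed_span M I e"
  unfolding L2_closed_span_def
proof (intro CollectI conjI allI impI)
  show "(\<lambda>x. f x + g x) \<in> L2 M"
    using f g by (intro L2_add closed_span_L2)
next
  fix \<epsilon> :: real assume "\<epsilon> > 0"
  then have e4: "\<epsilon> / 4 > 0" by simp
  obtain F c where F: "finite F" "F \<subseteq> I"
    and Fc: "(LINT x|M. (cmod (f x - (\<Sum>i\<in>F. c i * e i x)))\<^sup>2) < \<epsilon> / 4"
    using closed_spanD[OF f e4] .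
  obtain G d where G: "finite G" "G \<subseteq> I"
    and Gd: "(LINT x|M. (cmod (g x - (\<Sum>i\<in>G. d i * e i x)))\<^sup>2) < \<epsilon> / 4"
    using closed_spanD[OF g e4] .
  \<comment> \<open>The index sets \<open>F\<close> and \<open>G\<close> may overlap, so both
    coefficient families are extended by 0 and added.\<close>
  define k where "k i = (if i \<in> F then c i else 0) + (if i \<in> G then d i else 0)" for i
  have "(\<Sum>i\<in>F \<union> G. k i * e i x) = (\<Sum>i\<in>F. c i * e i x) + (\<Sum>i\<in>G. d i * e i x)" for x
  proof -
    have "(\<Sum>i\<in>F \<union> G. k i * e i x) = (\<Sum>i\<in>F \<union> G. if i \<in> F then c i * e i x else 0)
        + (\<Sum>i\<in>F \<union> G. if i \<in> G then d i * e i x else 0)"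
      unfolding sum.distrib[symmetric] by (intro sum.cong) (auto simp: k_def algebra_simps)
    also have "(\<Sum>i\<in>F \<union> G. if i \<in> F then c i * e i x else 0) = (\<Sum>i\<in>F. c i * e i x)"
      using F G by (intro sum.mono_neutral_cong_right) auto
    also have "(\<Sum>i\<in>F \<union> G. if i \<in> G then d i * e i x else 0) = (\<Sum>i\<in>G. d i * e i x)"
      using F G by (intro sum.mono_neutral_cong_right) auto
    finally show ?thesis .
  qed
  then have "(LINT x|M. (cmod (f x + g x - (\<Sum>i\<in>F \<union> G. k i * e i x)))\<^sup>2)
      = (LINT x|M. (cmod ((f x - (\<Sum>i\<in>F. c i * e i x)) + (g x - (\<Sum>i\<in>G. d i * e i x))))\<^sup>2)"
    by (simp add: algebra_simps)
  also have "\<dots> \<le> 2 * (LINT x|M. (cmod (f x - (\<Sum>i\<in>F. c i * e i x)))\<^sup>2)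
      + 2 * (LINT x|M. (cmod (g x - (\<Sum>i\<in>G. d i * e i x)))\<^sup>2)"
    using f g F G by (intro integral_norm_add_squared_le L2_diff closed_span_L2 span_L2)
  also have "\<dots> < \<epsilon>" using Fc Gd by simp
  finally show "\<exists>F c. finite F \<and> F \<subseteq> I \<and>
      (LINT x|M. (cmod (f x + g x - (\<Sum>i\<in>F. c i * e i x)))\<^sup>2) < \<epsilon>"
    using F G by (intro exI[of _ "F \<union> G"] exI[of _ k]) auto
qed

lemma closed_span_scale:
  assumes f: "f \<in> L2_closed_span M I e"
  shows "(\<lambda>x. k * f x) \<in> L2_closed_span M I e"
proof (cases "k = 0")
  case True
  then show ?thesis using closed_span_zero by simp
next
  case False
  show ?thesis
    unfolding L2_closed_span_def
  proof (intro CollectI conjI allI impI)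
    show "(\<lambda>x. k * f x) \<in> L2 M"
      using f by (intro L2_scale closed_span_L2)
  next
    fix \<epsilon> :: real assume "\<epsilon> > 0"
    then have "\<epsilon> / (cmod k)\<^sup>2 > 0" using False by simp
    then obtain F c where F: "finite F" "F \<subseteq> I"
      and Fc: "(LINT x|M. (cmod (f x - (\<Sum>i\<in>F. c i * e i x)))\<^sup>2) < \<epsilon> / (cmod k)\<^sup>2"
      using closed_spanD[OF f] by blast
    have "k * f x - (\<Sum>i\<in>F. (k * c i) * e i x) = k * (f x - (\<Sum>i\<in>F. c i * e i x))" for x
      by (simp add: right_diff_distrib sum_distrib_left mult.assoc)
    then have "(LINT x|M. (cmod (k * f x - (\<Sum>i\<in>F. (k * c i) * e i x)))\<^sup>2)
        = (cmod k)\<^sup>2 * (LINT x|M. (cmod (f x - (\<Sum>i\<in>F. c i * e i x)))\<^sup>2)"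
      by (simp add: norm_mult power_mult_distrib)
    also have "\<dots> < \<epsilon>" using Fc False by (simp add: field_simps)
    finally show "\<exists>F c. finite F \<and> F \<subseteq> I \<and>
        (LINT x|M. (cmod (k * f x - (\<Sum>i\<in>F. c i * e i x)))\<^sup>2) < \<epsilon>"
      using F by (intro exI[of _ F] exI[of _ "\<lambda>i. k * c i"]) auto
  qed
qed

lemma closed_span_sum:
  assumes "\<And>j. j \<in> J \<Longrightarrow> f j \<in> L2_closed_span M I e"
  shows "(\<lambda>x. \<Sum>j\<in>J. f j x) \<in> L2_closed_span M I e"
  using assms
  by (induction J rule: infinite_finite_induct) (auto simp: closed_span_zero intro: closed_span_add)

text \<open>Since \<open>|g - s n|^2\<close> is dominated by \<open>4 * w^2\<close>, pointwise
  convergence becomes convergence in the squared norm; approximating a late \<open>s n\<close> then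
  approximates \<open>g\<close>. All later limit arguments, and changes on null sets, go through
  this lemma.\<close>

lemma closed_span_dominated_limit:
  fixes w :: "'a \<Rightarrow> real"
  assumes s: "\<And>n. s n \<in> L2_closed_span M I e"
    and g: "g \<in> borel_measurable M"
    and lim: "AE x in M. (\<lambda>n. s n x) \<longlonglongrightarrow> g x"
    and w: "integrable M (\<lambda>x. (w x)\<^sup>2)"
    and bound: "\<And>n. AE x in M. cmod (s n x) \<le> w x"
  shows "g \<in> L2_closed_span M I e"
proof -
  have bounds: "AE x in M. \<forall>n. cmod (s n x) \<le> w x"
    using bound by (simp add: AE_all_countable)
  have gw: "AE x in M. cmod (g x) \<le> w x"
    using bounds lim
  proof eventually_elim
    case (elim x)
    show ?case
      by (rule tendsto_upperbound[OF tendsto_norm[OF elim(2)]]) (use elim in auto)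
  qed
  have gL2: "g \<in> L2 M"
    using gw by (intro L2I_dominated[OF g w]) (auto elim!: eventually_mono intro: power_mono)
  have sL2: "s n \<in> L2 M" for n
    using s by (rule closed_span_L2)
  note [measurable] = g sL2[THEN L2_borel]
  have "(\<lambda>n. LINT x|M. (cmod (g x - s n x))\<^sup>2) \<longlonglongrightarrow> (LINT x|M. 0)"
  proof (rule integral_dominated_convergence)
    show "integrable M (\<lambda>x. 4 * (w x)\<^sup>2)" using w by simp
    show "AE x in M. (\<lambda>n. (cmod (g x - s n x))\<^sup>2) \<longlonglongrightarrow> 0"
      using lim
    proof eventually_elim
      case (elim x)
      have "(\<lambda>n. (cmod (g x - s n x))\<^sup>2) \<longlonglongrightarrow> (cmod (g x - g x))\<^sup>2"
        by (intro tendsto_intros elim)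
      then show ?case by simp
    qed
    show "AE x in M. norm ((cmod (g x - s n x))\<^sup>2) \<le> 4 * (w x)\<^sup>2" for n
      using gw bound[of n]
    proof eventually_elim
      case (elim x)
      have "cmod (g x - s n x) \<le> 2 * w x"
        using norm_triangle_ineq4[of "g x" "s n x"] elim by linarith
      then have "(cmod (g x - s n x))\<^sup>2 \<le> (2 * w x)\<^sup>2"
        by (intro power_mono) auto
      then show ?case by (simp add: power_mult_distrib)
    qed
  qed measurable
  then have conv: "(\<lambda>n. LINT x|M. (cmod (g x - s n x))\<^sup>2) \<longlonglongrightarrow> 0" by simp
  show ?thesis
    unfolding L2_closed_span_def
  proof (intro CollectI conjI allI impI)
    show "g \<in> L2 M" by (rule gL2)
  next
    fix \<epsilon> :: real assume "\<epsilon> > 0"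
    then have e4: "\<epsilon> / 4 > 0" by simp
    obtain n where n: "(LINT x|M. (cmod (g x - s n x))\<^sup>2) < \<epsilon> / 4"
      using order_tendstoD(2)[OF conv e4] by (auto simp: eventually_sequentially)
    obtain F c where F: "finite F" "F \<subseteq> I"
      and Fc: "(LINT x|M. (cmod (s n x - (\<Sum>i\<in>F. c i * e i x)))\<^sup>2) < \<epsilon> / 4"
      using closed_spanD[OF s e4] .
    have "(LINT x|M. (cmod (g x - (\<Sum>i\<in>F. c i * e i x)))\<^sup>2)
        = (LINT x|M. (cmod ((g x - s n x) + (s n x - (\<Sum>i\<in>F. c i * e i x))))\<^sup>2)"
      by simp
    also have "\<dots> \<le> 2 * (LINT x|M. (cmod (g x - s n x))\<^sup>2)
        + 2 * (LINT x|M. (cmod (s n x - (\<Sum>i\<in>F. c i * e i x)))\<^sup>2)"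
      using F by (intro integral_norm_add_squared_le L2_diff gL2 sL2 span_L2)
    also have "\<dots> < \<epsilon>" using n Fc by simp
    finally show "\<exists>F c. finite F \<and> F \<subseteq> I \<and>
        (LINT x|M. (cmod (g x - (\<Sum>i\<in>F. c i * e i x)))\<^sup>2) < \<epsilon>"
      using F by blast
  qed
qed

text \<open>This is the limit lemma for the constant sequence \<open>f\<close> with majorant
  \<open>|f|\<close>.\<close>

lemma closed_span_AE_cong:
  assumes "f \<in> L2_closed_span M I e" "g \<in> borel_measurable M" "AE x in M. f x = g x"
  shows "g \<in> L2_closed_span M I e"
  using assms closed_span_L2[OF assms(1), THEN L2_integrable]
  by (intro closed_span_dominated_limit[of "\<lambda>_. f" g "\<lambda>x. cmod (f x)"])
     (auto elim!: eventually_mono)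

text \<open>By disjointness each partial sum is the indicator of a partial union, hence bounded by
  1, which is square-integrable because the measure is finite. This serves the union step of the
  Dynkin argument.\<close>

lemma closed_span_indicator_UN:
  fixes A :: "nat \<Rightarrow> 'a set"
  assumes fin: "finite_measure M" and disj: "disjoint_family A"
    and A: "\<And>n. A n \<in> sets M" "\<And>n. indicator (A n) \<in> L2_closed_span M I e"
  shows "indicator (\<Union>n. A n) \<in> L2_closed_span M I e"
proof (rule closed_span_dominated_limit[where w = "\<lambda>_. 1"])
  show "(\<lambda>x. \<Sum>i<n. indicator (A i) x) \<in> L2_closed_span M I e" for n
    using A(2) by (intro closed_span_sum)
  show "(indicator (\<Union>n. A n) :: 'a \<Rightarrow> complex) \<in> borel_measurable M"
    using A(1) by measurable
  have partial: "(\<Sum>i<n. indicator (A i) x :: complex) = indicator (\<Union>i<n. A i) x" for n x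
    using disj by (subst indicator_UN_disjoint) (auto simp: disjoint_family_on_def)
  show "AE x in M. (\<lambda>n. \<Sum>i<n. indicator (A i) x) \<longlonglongrightarrow> (indicator (\<Union>n. A n) x :: complex)"
    unfolding partial by (intro AE_I2 LIMSEQ_indicator_UN)
  show "integrable M (\<lambda>x. 1\<^sup>2 :: real)"
    using fin by (simp add: finite_measure.integrable_const)
  show "AE x in M. cmod (\<Sum>i<n. indicator (A i) x) \<le> 1" for n
    unfolding partial by (auto simp: indicator_def)
qed

text \<open>Simple functions converge to \<open>g\<close> pointwise with majorant
  \<open>2 * |g|\<close>, and each is a finite combination of indicators.\<close>

lemma closed_span_if_indicators:
  assumes ind: "\<And>A. A \<in> sets M \<Longrightarrow> indicator A \<in> L2_closed_span M I e"
    and g: "g \<in> L2 M"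
  shows "g \<in> L2_closed_span M I e"
proof -
  obtain s where s: "\<And>i. simple_function M (s i)"
    and lim: "\<And>x. x \<in> space M \<Longrightarrow> (\<lambda>i. s i x) \<longlonglongrightarrow> g x"
    and bnd: "\<And>i x. x \<in> space M \<Longrightarrow> dist (s i x) 0 \<le> 2 * dist (g x) 0"
    using borel_measurable_implies_sequence_metric[OF L2_borel[OF g], of 0] by blast
  show ?thesis
  proof (rule closed_span_dominated_limit[where s = s and w = "\<lambda>x. 2 * cmod (g x)"])
    fix i
    \<comment> \<open>\<open>?R\<close> is the canonical form of \<open>s i\<close>; outside
      \<open>space M\<close> the two may differ, hence the detour through almost-everywhere
      equality.\<close>
    let ?R = "\<lambda>x. \<Sum>y\<in>s i ` space M. y * indicator (s i -` {y} \<inter> space M) x"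
    have R: "?R \<in> L2_closed_span M I e"
      by (intro closed_span_sum closed_span_scale ind simple_functionD[OF s])
    have "?R x = s i x" if "x \<in> space M" for x
    proof -
      have "?R x = (\<Sum>y\<in>s i ` space M. if y = s i x then y else 0)"
        using that by (intro sum.cong) (auto simp: indicator_def)
      also have "\<dots> = s i x"
        using that simple_functionD(1)[OF s[of i]] by simp
      finally show ?thesis .
    qed
    then show "s i \<in> L2_closed_span M I e"
      by (intro closed_span_AE_cong[OF R] borel_measurable_simple_function s AE_I2)
  qed (use lim bnd g in \<open>auto simp: L2_def power_mult_distrib\<close>)
qed

end

section \<open>Farey neighbours\<close>

lemma to_circle_add: "to_circle (x + y) = to_circle x + to_circle y"
  by (simp add: plus_circle.abs_eq)

lemma to_circle_diff: "to_circle (x - y) = to_circle x - to_circle y"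
  by (simp add: minus_circle.abs_eq)

lemma to_circle_0: "to_circle 0 = 0"
  by (simp add: zero_circle_def)

lemma to_circle_1: "to_circle 1 = 0"
  by (simp flip: to_circle_0 add: to_circle_eq_iff)

lemma to_circle_inj:
  assumes "to_circle x = to_circle y" "\<bar>x - y\<bar> < 1"
  shows "x = y"
proof -
  from assms(1) obtain n :: int where n: "x - y = of_int n"
    by (auto simp: to_circle_eq_iff elim: Ints_cases)
  with assms(2) have "\<bar>n\<bar> < 1" by (metis of_int_abs of_int_less_1_iff)
  with n show ?thesis by simp
qed

lemma to_circle_surj_interval:
  obtains x where "0 \<le> x" "x < 1" "to_circle x = \<beta>"
proof -
  obtain y where y: "to_circle y = \<beta>"
    by (metis Quotient_circle Quotient_abs_rep)
  have "to_circle (frac y) = \<beta>"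
    unfolding y[symmetric] to_circle_eq_iff by (simp add: frac_def)
  with frac_ge_0 frac_lt_1 show thesis using that by blast
qed

text \<open>Together with \<open>circle_arcE\<close> this trades arcs for real intervals. The bound
  \<open>z < x + 1\<close> prevents the interval from covering a full turn.\<close>

lemma circle_arcI:
  assumes "a = to_circle x" "b = to_circle z" "x < y" "y < z" "z < x + 1"
  shows "to_circle y \<in> circle_arc a b"
  unfolding circle_arc_def mem_Collect_eq using assms
  by (intro exI[of _ "y - x"] exI[of _ "z - x"]) (auto simp: to_circle_diff)

lemma circle_arcE:
  assumes "\<gamma> \<in> circle_arc (to_circle x) (to_circle z)" "x < z" "z < x + 1"
  obtains y where "\<gamma> = to_circle y" "x < y" "y < z"
proof -
  from assms(1) obtain t d where td: "\<gamma> = to_circle x + to_circle t" "0 < t" "t < d" "d < 1"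
      "to_circle d = to_circle (z - x)"
    by (auto simp: circle_arc_def to_circle_diff)
  have "d = z - x"
    using td assms(2,3) by (intro to_circle_inj) auto
  with td show thesis
    by (intro that[of "x + t"]) (auto simp: to_circle_add)
qed

text \<open>Go back from \<open>\<beta>\<close> by \<open>x\<close> to reach \<open>\<gamma>\<close>
  and by \<open>y\<close> to reach \<open>\<delta>\<close>. If one of these distances were smaller,
  the nearer point would lie in the arc that starts at the farther one. This gives the uniqueness
  required by the description in \<open>left_nbr\<close>.\<close>

lemma left_gap_unique:
  assumes "\<gamma> \<in> S" "\<gamma> \<noteq> \<beta>" "circle_arc \<gamma> \<beta> \<inter> S = {}"
    and "\<delta> \<in> S" "\<delta> \<noteq> \<beta>" "circle_arc \<delta> \<beta> \<inter> S = {}"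
  shows "\<gamma> = \<delta>"
proof -
  obtain b where b: "to_circle b = \<beta>" by (rule to_circle_surj_interval)
  obtain x where x: "0 \<le> x" "x < 1" "to_circle x = \<beta> - \<gamma>" by (rule to_circle_surj_interval)
  obtain y where y: "0 \<le> y" "y < 1" "to_circle y = \<beta> - \<delta>" by (rule to_circle_surj_interval)
  have \<gamma>: "\<gamma> = to_circle (b - x)" and \<delta>: "\<delta> = to_circle (b - y)"
    using b x y by (simp_all add: to_circle_diff)
  have "x \<noteq> 0" "y \<noteq> 0" using \<gamma> \<delta> b assms(2,5) by auto
  then have "x > 0" "y > 0" using x y by auto
  then have "\<not> x < y" "\<not> y < x"
    using circle_arcI[OF \<delta> b[symmetric], of "b - x"] circle_arcI[OF \<gamma> b[symmetric], of "b - y"]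
      assms(1,3,4,6) x y \<gamma> \<delta> by auto
  then have "x = y" by simp
  then show ?thesis using \<gamma> \<delta> by simp
qed

lemma right_gap_unique:
  assumes "\<gamma> \<in> S" "\<gamma> \<noteq> \<beta>" "circle_arc \<beta> \<gamma> \<inter> S = {}"
    and "\<delta> \<in> S" "\<delta> \<noteq> \<beta>" "circle_arc \<beta> \<delta> \<inter> S = {}"
  shows "\<gamma> = \<delta>"
proof -
  obtain b where b: "to_circle b = \<beta>" by (rule to_circle_surj_interval)
  obtain x where x: "0 \<le> x" "x < 1" "to_circle x = \<gamma> - \<beta>" by (rule to_circle_surj_interval)
  obtain y where y: "0 \<le> y" "y < 1" "to_circle y = \<delta> - \<beta>" by (rule to_circle_surj_interval)
  have \<gamma>: "\<gamma> = to_circle (b + x)" and \<delta>: "\<delta> = to_circle (b + y)"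
    using b x y by (simp_all add: to_circle_add)
  have "x \<noteq> 0" "y \<noteq> 0" using \<gamma> \<delta> b assms(2,5) by auto
  then have "x > 0" "y > 0" using x y by auto
  then have "\<not> x < y" "\<not> y < x"
    using circle_arcI[OF b[symmetric] \<delta>, of "b + x"] circle_arcI[OF b[symmetric] \<gamma>, of "b + y"]
      assms(1,3,4,6) x y \<gamma> \<delta> by auto
  then have "x = y" by simp
  then show ?thesis using \<gamma> \<delta> by simp
qed

section \<open>Reduced fractions, gaps and neighbours in Farey sets\<close>

lemma rational_circleE:
  assumes "\<beta> \<in> rational_circle"
  obtains a q where "q \<ge> 1" "coprime a (int q)" "\<beta> = to_circle (of_int a / of_nat q)"
proof -
  from assms obtain x where x: "x \<in> \<rat>" "\<beta> = to_circle x"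
    by (auto simp: rational_circle_def)
  from x(1) obtain a b :: int where "b > 0" "coprime a b" "x = of_int a / of_int b"
    by (rule Rats_cases')
  with x(2) show thesis
    by (intro that[of "nat b" a]) auto
qed

lemma fraction_in_farey:
  assumes "q \<ge> 1" "coprime a (int q)" "q \<le> Q"
  shows "to_circle (of_int a / of_nat q) \<in> farey Q"
  using assms height_eq[OF assms(1,2)]
  by (auto simp: farey_def rational_circle_def)

text \<open>Shifting a reduced fraction by an integer \<open>n\<close> turns the numerator
  \<open>a\<close> into \<open>a + n * int q\<close>, still coprime to \<open>q\<close>. So the
  given real \<open>x\<close> itself is a reduced fraction, whichever representative it is.\<close>

lemma fareyE:
  assumes "to_circle x \<in> farey Q"
  obtains m v where "1 \<le> v" "v \<le> Q" "coprime m (int v)" "x = of_int m / of_nat v"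
proof -
  from assms obtain a q where aq: "q \<ge> 1" "coprime a (int q)"
      "to_circle x = to_circle (of_int a / of_nat q)"
    unfolding farey_def by (auto elim: rational_circleE)
  with assms have "q \<le> Q"
    using height_eq[OF aq(1,2)] by (simp add: farey_def)
  from aq(3) obtain n :: int where "x - of_int a / of_nat q = of_int n"
    by (auto simp: to_circle_eq_iff elim: Ints_cases)
  then have "x = of_int (a + n * int q) / of_nat q"
    using aq(1) by (simp add: field_simps)
  moreover have "coprime (a + n * int q) (int q)"
    using aq(2) gcd_add_mult[of "int q" n a]
    by (simp add: coprime_iff_gcd_eq_1 gcd.commute[of _ "int q"] add.commute)
  ultimately show thesis
    using that aq(1) \<open>q \<le> Q\<close> by blast
qed

text \<open>Between two fractions of determinant 1, a denominator is the combination of the two outer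
  denominators with positive integer coefficients.\<close>

lemma denominator_between:
  fixes a b m :: int and p q v :: nat
  assumes det: "b * int p - a * int q = 1" and pos: "p \<ge> 1" "q \<ge> 1" "v \<ge> 1"
    and lt: "real_of_int a / p < of_int m / v" "real_of_int m / v < of_int b / q"
  shows "p + q \<le> v"
proof -
  have "real_of_int (a * int v) < real_of_int (m * int p)"
       "real_of_int (m * int q) < real_of_int (b * int v)"
    using lt pos by (simp_all add: field_simps)
  then have "1 \<le> m * int p - a * int v" "1 \<le> b * int v - m * int q"
    by linarith+
  then have "int q * 1 + int p * 1 \<le> int q * (m * int p - a * int v) + int p * (b * int v - m * int q)"
    by (intro add_mono mult_left_mono) auto
  also have "\<dots> = int v * (b * int p - a * int q)" by (simp add: algebra_simps)
  finally show ?thesis using det by simp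
qed

text \<open>A fraction strictly inside would have denominator at least \<open>p + q\<close>, which
  exceeds \<open>Q\<close>.\<close>

lemma farey_gap:
  fixes a b :: int and p q Q :: nat
  assumes det: "b * int p - a * int q = 1" and pos: "p \<ge> 1" "q \<ge> 1" and Q: "Q < p + q"
  shows "circle_arc (to_circle (of_int a / p)) (to_circle (of_int b / q)) \<inter> farey Q = {}"
\<comment> \<open>If \<open>p = q = 1\<close>, the endpoints are a full turn apart, so they coincide
  on the circle and \<open>circle_arc\<close> is empty by definition. Otherwise the length
  \<open>1 / (p * q)\<close> is below 1 and the arc is a real interval.\<close>
proof (cases "p = 1 \<and> q = 1")
  case True
  then have "to_circle (of_int b / q) = to_circle (of_int a / p)"
    using det by (simp add: to_circle_eq_iff)
  then have "circle_arc (to_circle (of_int a / p)) (to_circle (of_int b / q)) = {}"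
    unfolding circle_arc_def
    by (auto dest!: to_circle_inj[of _ 0, unfolded to_circle_0])
  then show ?thesis by simp
next
  case False
  have "real_of_int b / q - of_int a / p = 1 / (p * q)"
  proof -
    have "real_of_int b / q - of_int a / p = of_int (b * int p - a * int q) / (p * q)"
      using pos by (simp add: field_simps)
    then show ?thesis by (simp only: det of_int_1)
  qed
  moreover have "p * q > 1"
  proof -
    have "p * q \<noteq> 1" "p * q \<noteq> 0" using False pos by auto
    then show ?thesis by linarith
  qed
  ultimately have lt: "real_of_int a / p < of_int b / q" "real_of_int b / q < of_int a / p + 1"
    by (smt (verit) divide_less_eq_1_pos of_nat_1 of_nat_less_iff of_nat_mult zero_less_divide_iff)+
  have False if \<gamma>: "\<gamma> \<in> circle_arc (to_circle (of_int a / p)) (to_circle (of_int b / q))"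
    "\<gamma> \<in> farey Q" for \<gamma>
  proof -
    obtain y where y: "\<gamma> = to_circle y" "of_int a / p < y" "y < of_int b / q"
      using circle_arcE[OF \<gamma>(1) lt] .
    obtain m v where "1 \<le> v" "v \<le> Q" "y = of_int m / of_nat v"
      using \<gamma>(2) unfolding y(1) by (rule fareyE)
    then show False
      using denominator_between[OF det pos, of v m] y Q by simp
  qed
  then show ?thesis by blast
qed

text \<open>Determinant 1 makes both fractions reduced and, as \<open>q < p + q\<close>, leaves a
  gap of order \<open>q\<close> between them; \<open>p < q\<close> separates the two points by their
  heights. Uniqueness of the gap then evaluates the description.\<close>

lemma left_nbr_eqI:
  assumes det: "a * int p - c * int q = 1" and pos: "1 \<le> p" "p < q"
  shows "left_nbr (to_circle (of_int a / q)) = to_circle (of_int c / p)"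
    and "height (to_circle (of_int c / p)) = p"
proof -
  have cop: "coprime a (int q)" "coprime c (int p)"
    using det by (metis coprimeI dvd_diff dvd_mult2 dvd_mult)+
  have h: "height (to_circle (of_int a / q)) = q" "height (to_circle (of_int c / p)) = p"
    using cop pos by (auto intro!: height_eq)
  then show "height (to_circle (of_int c / p)) = p" by simp
  have P: "to_circle (of_int c / p) \<in> farey q" "to_circle (of_int c / p) \<noteq> to_circle (of_int a / q)"
    "circle_arc (to_circle (of_int c / p)) (to_circle (of_int a / q)) \<inter> farey q = {}"
    using cop pos h farey_gap[OF det, of q] by (auto intro: fraction_in_farey)
  then show "left_nbr (to_circle (of_int a / q)) = to_circle (of_int c / p)"
    unfolding left_nbr_def h by (intro the_equality conjI) (auto intro: left_gap_unique)
qed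

lemma right_nbr_eqI:
  assumes det: "c * int q - a * int p = 1" and pos: "1 \<le> p" "p < q"
  shows "right_nbr (to_circle (of_int a / q)) = to_circle (of_int c / p)"
    and "height (to_circle (of_int c / p)) = p"
proof -
  have cop: "coprime a (int q)" "coprime c (int p)"
    using det by (metis coprimeI dvd_diff dvd_mult2 dvd_mult)+
  have h: "height (to_circle (of_int a / q)) = q" "height (to_circle (of_int c / p)) = p"
    using cop pos by (auto intro!: height_eq)
  then show "height (to_circle (of_int c / p)) = p" by simp
  have P: "to_circle (of_int c / p) \<in> farey q" "to_circle (of_int c / p) \<noteq> to_circle (of_int a / q)"
    "circle_arc (to_circle (of_int a / q)) (to_circle (of_int c / p)) \<inter> farey q = {}"
    using cop pos h farey_gap[OF det, of q] by (auto intro: fraction_in_farey)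
  then show "right_nbr (to_circle (of_int a / q)) = to_circle (of_int c / p)"
    unfolding right_nbr_def h by (intro the_equality conjI) (auto intro: right_gap_unique)
qed

text \<open>This writes \<open>a / q\<close> as the mediant of \<open>c / p\<close> and
  \<open>d / r\<close>, its future left and right neighbours. The bounds on \<open>c\<close> and
  \<open>d\<close> put both in \<open>[0, 1]\<close>, with 1 allowed on the right only.\<close>

lemma farey_parents_exist:
  fixes a :: int and q :: nat
  assumes "coprime a (int q)" "0 < a" "a < int q"
  obtains c d :: int and p r :: nat where
    "q = p + r" "a = c + d" "1 \<le> p" "1 \<le> r" "0 \<le> c" "c < int p" "0 < d" "d \<le> int r"
    "a * int p - c * int q = 1" "d * int q - a * int r = 1"
proof -
  have q: "q \<ge> 2" using assms by linarith
  obtain u v where uv: "u * a + v * int q = 1"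
    using bezout_int[of a "int q"] assms(1) by auto
  \<comment> \<open>\<open>p\<close> is the inverse of \<open>a\<close> modulo \<open>q\<close>, so
    \<open>a * p - 1\<close> is a multiple of \<open>q\<close>; the cofactor is
    \<open>c\<close>.\<close>
  define p where "p = nat (u mod int q)"
  have p: "int p = u - int q * (u div int q)"
    unfolding p_def using q by (simp add: minus_mult_div_eq_mod)
  define c where "c = - (v + a * (u div int q))"
  have c: "a * int p - 1 = int q * c"
    using uv unfolding p c_def by (simp add: algebra_simps)
  have "p < q" unfolding p_def using q by (simp add: nat_less_iff)
  have "p \<noteq> 0"
  proof
    assume "p = 0"
    then have "int q dvd 1" using c by (metis dvd_triv_left dvd_minus_iff mult_zero_right of_nat_0 diff_0)
    then show False using q by simp
  qed
  then have p1: "1 \<le> p" by simp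
  have "0 < a * int p" using assms(2) p1 by simp
  then have "0 \<le> int q * c" using c by linarith
  then have c0: "0 \<le> c" using q by (simp add: zero_le_mult_iff)
  have "int q * c < int q * int p"
    using c assms p1 mult_strict_right_mono[of a "int q" "int p"] by linarith
  then have cp: "c < int p" using q by simp
  \<comment> \<open>The right parent is what remains of the mediant. Its determinant
    \<open>(a - c) * q - a * (q - p)\<close> equals the left one,
    \<open>a * p - c * q\<close>.\<close>
  define r where "r = q - p"
  have r: "q = p + r" "1 \<le> r" using \<open>p < q\<close> by (auto simp: r_def)
  define d where "d = a - c"
  have det2: "d * int q - a * int r = 1"
    using c r(1) by (simp add: d_def algebra_simps)
  have "0 \<le> a * int r" using assms(2) by simp
  then have "0 < d * int q" using det2 by linarith
  then have d0: "0 < d" using q by (simp add: zero_less_mult_iff)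
  have "d * int q \<le> 1 + (int q - 1) * int r"
    using det2 assms(3) mult_right_mono[of a "int q - 1" "int r"] by simp
  also have "\<dots> \<le> int r * int q" using r(2) by (simp add: algebra_simps)
  finally have dr: "d \<le> int r" using q by simp
  show thesis
    using c by (intro that[of p r c d] r p1 c0 cp d0 dr det2) (auto simp: d_def algebra_simps)
qed

section \<open>The functions \<open>f\<^sub>\<beta>\<close> as step functions\<close>

abbreviation unit_lebesgue :: "real measure" where
  "unit_lebesgue \<equiv> restrict_space lborel {0..<1}"

lemma psi_to_circle_diff:
  assumes "0 < x" "x < 1" "0 \<le> c" "c \<le> 1" "x \<noteq> c"
  shows "psi (to_circle x - to_circle c) = x - c - 1 / 2 + indicator {..<c} x"
proof -
  have "x - c \<notin> \<int>"
  proof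
    assume "x - c \<in> \<int>"
    then have "to_circle x = to_circle c" by (simp add: to_circle_eq_iff)
    then have "x = c" using assms by (intro to_circle_inj) auto
    with assms show False by simp
  qed
  moreover have "\<lfloor>x - c\<rfloor> = (if x < c then - 1 else 0)"
    using assms by (auto simp: floor_eq_iff)
  ultimately show ?thesis
    using assms by (simp flip: to_circle_diff add: psi.abs_eq)
qed

section \<open>Boundedness and Borel measurability of \<open>psi\<close> and
  \<open>farey_fun\<close>\<close>

lemma abs_psi_le: "\<bar>psi y\<bar> \<le> 1 / 2"
proof -
  obtain x where x: "to_circle x = y" by (rule to_circle_surj_interval)
  have "0 \<le> x - of_int \<lfloor>x\<rfloor>" "x - of_int \<lfloor>x\<rfloor> < 1" by linarith+
  then have "\<bar>x - of_int \<lfloor>x\<rfloor> - 1 / 2\<bar> \<le> 1 / 2" by linarith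
  then show ?thesis unfolding x[symmetric] psi.abs_eq by simp
qed

text \<open>Away from its jump at 0, \<open>psi\<close> is continuous: lifted to the line it is
  affine between consecutive integers.\<close>

lemma open_psi_vimage:
  assumes "open S"
  shows "open (psi -` S - {0})"
proof -
  have "x \<in> to_circle -` (psi -` S - {0}) \<longleftrightarrow>
      x \<in> (\<Union>n::int. {of_int n <..< of_int n + 1} \<inter> (\<lambda>x. x - of_int n - 1 / 2) -` S)" for x
  proof -
    have zero: "to_circle x = 0 \<longleftrightarrow> x \<in> \<int>"
      by (simp flip: to_circle_0 add: to_circle_eq_iff)
    show ?thesis
    proof
      assume "x \<in> to_circle -` (psi -` S - {0})"
      then have "x \<notin> \<int>" "x - of_int \<lfloor>x\<rfloor> - 1 / 2 \<in> S"
        by (auto simp: zero psi.abs_eq split: if_splits)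
      moreover have "of_int \<lfloor>x\<rfloor> \<noteq> x" using \<open>x \<notin> \<int>\<close> by (metis Ints_of_int)
      then have "of_int \<lfloor>x\<rfloor> < x" "x < of_int \<lfloor>x\<rfloor> + 1" by linarith+
      ultimately show "x \<in> (\<Union>n::int. {of_int n <..< of_int n + 1} \<inter> (\<lambda>x. x - of_int n - 1 / 2) -` S)"
        by auto
    next
      assume "x \<in> (\<Union>n::int. {of_int n <..< of_int n + 1} \<inter> (\<lambda>x. x - of_int n - 1 / 2) -` S)"
      then obtain n :: int where n: "of_int n < x" "x < of_int n + 1" "x - of_int n - 1 / 2 \<in> S"
        by auto
      then have "\<lfloor>x\<rfloor> = n" by linarith
      moreover have "x \<notin> \<int>" using n by (auto elim!: Ints_cases)
      ultimately show "x \<in> to_circle -` (psi -` S - {0})"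
        using n by (auto simp: zero psi.abs_eq)
    qed
  qed
  then have "to_circle -` (psi -` S - {0}) =
      (\<Union>n::int. {of_int n <..< of_int n + 1} \<inter> (\<lambda>x. x - of_int n - 1 / 2) -` S)"
    by blast
  moreover have "open \<dots>"
    using assms by (intro open_UN ballI open_Int open_vimage continuous_intros) auto
  ultimately show ?thesis by (simp add: open_circle_def)
qed

lemma closed_zero_circle: "closed {0 :: circle}"
proof -
  have "to_circle -` (- {0}) = - \<int>"
    by (auto simp flip: to_circle_0 simp add: to_circle_eq_iff)
  then show ?thesis
    using closed_Ints[where 'a = real] by (simp add: closed_def open_circle_def)
qed

lemma psi_measurable [measurable]: "psi \<in> borel_measurable borel"
proof (rule borel_measurableI)
  fix S :: "real set" assume "open S"
  then have "psi -` S - {0} \<in> sets borel" by (intro borel_open open_psi_vimage)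
  moreover have "{0 :: circle} \<in> sets borel" by (intro borel_closed closed_zero_circle)
  moreover have "psi -` S \<inter> space borel = (if psi 0 \<in> S then (psi -` S - {0}) \<union> {0} else psi -` S - {0})"
    by auto
  ultimately show "psi -` S \<inter> space borel \<in> sets borel" by (metis sets.Un)
qed

lemma translate_measurable [measurable]: "(\<lambda>x :: circle. x - \<beta>) \<in> borel_measurable borel"
proof (rule borel_measurableI)
  fix S :: "circle set" assume "open S"
  obtain b where b: "to_circle b = \<beta>" by (rule to_circle_surj_interval)
  have "to_circle -` ((\<lambda>x. x - \<beta>) -` S) = (\<lambda>x. x - b) -` (to_circle -` S)"
    by (auto simp: to_circle_diff b)
  moreover have "open \<dots>"
    by (rule open_vimage) (use \<open>open S\<close> in \<open>auto simp: open_circle_def intro!: continuous_intros\<close>)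
  ultimately have "open ((\<lambda>x. x - \<beta>) -` S)" by (simp add: open_circle_def)
  then show "(\<lambda>x. x - \<beta>) -` S \<inter> space borel \<in> sets borel" by simp
qed

lemma farey_fun_measurable [measurable]: "farey_fun \<beta> \<in> borel_measurable borel"
  unfolding farey_fun_def by measurable

lemma farey_fun_bounded: "\<exists>B. \<forall>x. \<bar>farey_fun \<beta> x\<bar> \<le> B"
proof (intro exI allI)
  fix x
  have "\<bar>real n * psi y\<bar> \<le> real n" for n y
    using abs_psi_le[of y] mult_left_mono[of "\<bar>psi y\<bar>" 1 "real n"] by (simp add: abs_mult)
  from this[of "height \<beta>" "x - \<beta>"] this[of "height (left_nbr \<beta>)" "x - left_nbr \<beta>"]
    this[of "height (right_nbr \<beta>)" "x - right_nbr \<beta>"]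
  show "\<bar>farey_fun \<beta> x\<bar> \<le> 1 + real (height \<beta>) + real (height (left_nbr \<beta>))
      + real (height (right_nbr \<beta>))"
    unfolding farey_fun_def by auto
qed

section \<open>Transfer of integrals from the circle to the unit interval\<close>

lemma finite_measure_unit_lebesgue: "finite_measure unit_lebesgue"
  by (rule finite_measureI) (simp add: emeasure_restrict_space space_restrict_space)

lemma AE_unit_lebesgue_neq: "AE x in unit_lebesgue. x \<noteq> c"
  using AE_lborel_singleton[of c] by (auto simp: AE_restrict_space_iff elim: eventually_mono)

lemma AE_unit_lebesgue_in: "AE x in unit_lebesgue. 0 < x \<and> x < 1"
  using AE_unit_lebesgue_neq[of 0] AE_space
  by eventually_elim (auto simp: space_restrict_space)

lemma to_circle_unit_measurable [measurable]:
  "f \<in> borel_measurable borel \<Longrightarrow> (\<lambda>x. f (to_circle x)) \<in> borel_measurable unit_lebesgue"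
  by (intro measurable_restrict_space1) simp

lemma integral_haar_circle:
  fixes f :: "circle \<Rightarrow> 'b :: {banach, second_countable_topology}"
  assumes "f \<in> borel_measurable borel"
  shows "(LINT x|haar_circle. f x) = (LINT x|unit_lebesgue. f (to_circle x))"
  unfolding haar_circle_def
  by (rule integral_distr[OF to_circle_measurable_fundamental assms])

lemma borel_measurable_haar_circle [simp]: "borel_measurable haar_circle = borel_measurable borel"
  unfolding haar_circle_def by (intro measurable_cong_sets) auto

lemma L2_haar_circle_iff:
  assumes "f \<in> borel_measurable borel"
  shows "f \<in> L2 haar_circle \<longleftrightarrow> (\<lambda>x. f (to_circle x)) \<in> L2 unit_lebesgue"
proof -
  have "integrable haar_circle (\<lambda>x. (cmod (f x))\<^sup>2) \<longleftrightarrow>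
      integrable unit_lebesgue (\<lambda>x. (cmod (f (to_circle x)))\<^sup>2)"
    unfolding haar_circle_def using assms
    by (intro integrable_distr_eq to_circle_measurable_fundamental) measurable
  then show ?thesis
    using assms by (simp add: L2_def to_circle_unit_measurable)
qed

lemma farey_fun_L2: "(\<lambda>x. complex_of_real (farey_fun \<beta> (to_circle x))) \<in> L2 unit_lebesgue"
proof -
  obtain B where B: "\<And>x. \<bar>farey_fun \<beta> x\<bar> \<le> B" using farey_fun_bounded by blast
  show ?thesis
  proof (rule L2I_dominated)
    show "integrable unit_lebesgue (\<lambda>x. B\<^sup>2)"
      by (intro finite_measure.integrable_const finite_measure_unit_lebesgue)
    show "(\<lambda>x. complex_of_real (farey_fun \<beta> (to_circle x))) \<in> borel_measurable unit_lebesgue"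
      by (rule to_circle_unit_measurable) measurable
  qed (use B in \<open>auto intro!: AE_I2 simp: abs_le_square_iff[symmetric] intro: order_trans[OF B abs_ge_self]\<close>)
qed

lemma integrable_unit_indicator:
  fixes c :: real
  shows "integrable unit_lebesgue (indicator {..<c} :: real \<Rightarrow> real)"
  by (rule finite_measure.integrable_const_bound[OF finite_measure_unit_lebesgue, where B = 1])
     (auto simp: indicator_def intro!: measurable_restrict_space1)

lemma integral_unit_indicator:
  assumes "0 \<le> c" "c \<le> 1"
  shows "(LINT x|unit_lebesgue. indicator {..<c} x) = c"
proof -
  have "{..<c} \<inter> {0..<1} = {0..<c}" using assms by auto
  then have "(LINT x|unit_lebesgue. indicator {..<c} x) = measure unit_lebesgue {0..<c}"
    by (simp add: space_restrict_space)
  also have "\<dots> = measure lborel {0..<c}"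
    using assms by (subst measure_restrict_space) auto
  finally show ?thesis using assms by simp
qed

text \<open>Collects the facts on which the integral computations and the density induction rest.
  The neighbours appear as reals \<open>l\<close> and \<open>u\<close> in \<open>[0, 1]\<close>, so
  that \<open>u = 1\<close> can stand for the point 0. The mediant identity cancels the linear parts
  of the three sawtooth terms and leaves three steps.\<close>

lemma farey_fun_cases:
  assumes "\<beta> \<in> rational_circle" "\<beta> \<noteq> 0"
  obtains p r :: nat and b l u :: real where
    "height \<beta> = p + r" "1 \<le> p" "1 \<le> r" "\<beta> = to_circle b"
    "to_circle l \<in> rational_circle" "height (to_circle l) = p"
    "to_circle u \<in> rational_circle" "height (to_circle u) = r"
    "0 \<le> l" "l < b" "b < u" "u \<le> 1"
    "(real p + real r) * b = real p * l + real r * u" "real p * (b - l) = 1 / (real p + real r)"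
    "\<forall>c. to_circle c \<in> farey (height \<beta>) \<longrightarrow> c \<le> l \<or> c = b \<or> u \<le> c"
    "AE x in unit_lebesgue. farey_fun \<beta> (to_circle x) =
       (real p + real r) * indicator {..<b} x - real p * indicator {..<l} x - real r * indicator {..<u} x"
proof -
  obtain y where y: "0 \<le> y" "y < 1" "to_circle y = \<beta>" by (rule to_circle_surj_interval)
  then have "to_circle y \<in> farey (height \<beta>)" using assms(1) by (simp add: farey_def)
  then obtain a q where q: "1 \<le> q" "coprime a (int q)" "y = of_int a / of_nat q"
    by (rule fareyE)
  have "y \<noteq> 0" using y assms(2) to_circle_0 by auto
  then have "0 < a" "a < int q" using y q by (auto simp: field_simps)
  then obtain c d :: int and p r :: nat where pr: "q = p + r" "a = c + d" "1 \<le> p" "1 \<le> r"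
      and cd: "0 \<le> c" "c < int p" "0 < d" "d \<le> int r"
      and det: "a * int p - c * int q = 1" "d * int q - a * int r = 1"
    using farey_parents_exist[OF q(2)] by metis
  define l where "l = of_int c / real p"
  define u where "u = of_int d / real r"
  have h: "height \<beta> = q" using height_eq[OF q(1,2)] y q by simp
  have det': "of_int a * real p - of_int c * real q = 1" "of_int d * real q - of_int a * real r = 1"
    using det by (metis of_int_1 of_int_diff of_int_mult of_int_of_nat_eq)+
  have nbrs: "left_nbr \<beta> = to_circle l" "height (to_circle l) = p"
      "right_nbr \<beta> = to_circle u" "height (to_circle u) = r"
    using left_nbr_eqI[OF det(1)] right_nbr_eqI[OF det(2)] pr y q unfolding l_def u_def by auto
  have lby: "y - l = 1 / (real p * real q)" "u - y = 1 / (real r * real q)"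
    using det' pr(3,4) q(1) unfolding l_def u_def q(3) by (auto simp: field_simps)
  then have ord: "0 \<le> l" "l < y" "y < u" "u \<le> 1"
    using cd pr q(1) by (auto simp: l_def u_def) (smt (verit) of_nat_0_less_iff zero_less_divide_1_iff mult_pos_pos)+
  have mediant: "(real p + real r) * y = real p * l + real r * u"
    using pr unfolding l_def u_def q(3) by auto
  \<comment> \<open>A fraction in \<open>(l, y)\<close> would have denominator at least
    \<open>p + q\<close>, one in \<open>(y, u)\<close> at least \<open>q + r\<close>; both exceed
    \<open>q\<close>.\<close>
  have gap: "x \<le> l \<or> x = y \<or> u \<le> x" if x: "to_circle x \<in> farey q" for x
  proof -
    obtain m v where v: "1 \<le> v" "v \<le> q" "x = of_int m / of_nat v"
      using x by (rule fareyE)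
    then show ?thesis
      using denominator_between[OF det(1) pr(3) q(1) v(1), of m]
        denominator_between[OF det(2) q(1) pr(4) v(1), of m] pr(3,4)
      unfolding l_def u_def q(3) by force
  qed
  have step: "AE x in unit_lebesgue. farey_fun \<beta> (to_circle x) =
       (real p + real r) * indicator {..<y} x - real p * indicator {..<l} x - real r * indicator {..<u} x"
    using AE_unit_lebesgue_in AE_unit_lebesgue_neq[of y] AE_unit_lebesgue_neq[of l]
      AE_unit_lebesgue_neq[of u]
  proof eventually_elim
    case (elim x)
    have "farey_fun \<beta> (to_circle x) = real q * (x - y - 1 / 2 + indicator {..<y} x)
        - real p * (x - l - 1 / 2 + indicator {..<l} x) - real r * (x - u - 1 / 2 + indicator {..<u} x)"
      using psi_to_circle_diff[of x y] psi_to_circle_diff[of x l] psi_to_circle_diff[of x u]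
        elim ord assms(2) unfolding y(3) by (simp add: farey_fun_def h nbrs)
    also have "\<dots> = (real p + real r) * indicator {..<y} x - real p * indicator {..<l} x
        - real r * indicator {..<u} x"
      using mediant pr(1) by (simp add: algebra_simps)
    finally show ?case .
  qed
  show thesis
  proof (rule that[of p r y l u])
    show "to_circle l \<in> rational_circle" "to_circle u \<in> rational_circle"
      by (auto simp: rational_circle_def l_def u_def)
    show "real p * (y - l) = 1 / (real p + real r)"
      using pr by (simp add: lby)
  qed (use h pr y nbrs ord mediant gap step in auto)
qed

text \<open>As a function of \<open>c\<close> the integral is a tent: 0 outside
  \<open>(l, u)\<close>, with peak \<open>p * (b - l) = 1 / (p + r)\<close> at \<open>b\<close>. The
  Farey condition on \<open>c\<close> leaves \<open>b\<close> as the only possible point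
  inside.\<close>

lemma integral_farey_fun_indicator:
  assumes "\<gamma> \<in> rational_circle" "\<gamma> \<noteq> 0" "0 \<le> c" "c \<le> 1" "to_circle c \<in> farey (height \<gamma>)"
  shows "(LINT x|unit_lebesgue. farey_fun \<gamma> (to_circle x) * indicator {..<c} x) =
    (if to_circle c = \<gamma> then 1 / real (height \<gamma>) else 0)"
proof -
  obtain p r :: nat and b l u :: real where
    h: "height \<gamma> = p + r" and "1 \<le> p" "1 \<le> r" and b: "\<gamma> = to_circle b"
    and "to_circle l \<in> rational_circle" "height (to_circle l) = p"
    "to_circle u \<in> rational_circle" "height (to_circle u) = r"
    and ord: "0 \<le> l" "l < b" "b < u" "u \<le> 1"
    and med: "(real p + real r) * b = real p * l + real r * u"
    and len: "real p * (b - l) = 1 / (real p + real r)"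
    and gap: "\<forall>c. to_circle c \<in> farey (height \<gamma>) \<longrightarrow> c \<le> l \<or> c = b \<or> u \<le> c"
    and step: "AE x in unit_lebesgue. farey_fun \<gamma> (to_circle x) =
       (real p + real r) * indicator {..<b} x - real p * indicator {..<l} x - real r * indicator {..<u} x"
    using farey_fun_cases[OF assms(1,2)] .
  have "(LINT x|unit_lebesgue. farey_fun \<gamma> (to_circle x) * indicator {..<c} x) =
      (LINT x|unit_lebesgue. (real p + real r) * indicator {..<min b c} x
         - real p * indicator {..<min l c} x - real r * indicator {..<min u c} x)"
    using step
    by (intro integral_cong_AE borel_measurable_times borel_measurable_diff to_circle_unit_measurable
          measurable_restrict_space1) (auto elim!: eventually_mono simp: indicator_def)
  also have "\<dots> = (real p + real r) * min b c - real p * min l c - real r * min u c"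
    using ord assms(3,4) by (simp add: integrable_unit_indicator integral_unit_indicator
        del: Bochner_Integration.integral_indicator)
  also have "\<dots> = (if c = b then 1 / (real p + real r) else 0)"
  proof -
    consider "c \<le> l" | "c = b" | "u \<le> c" using gap assms(5) by blast
    then show ?thesis
      using ord med len by cases (auto simp: min_def algebra_simps)
  qed
  \<comment> \<open>\<open>b\<close> lies strictly between 0 and 1, so no second number in
    \<open>[0, 1]\<close> represents the same point.\<close>
  also have "c = b \<longleftrightarrow> to_circle c = \<gamma>"
    using b ord assms(3,4) by (auto intro!: to_circle_inj)
  finally show ?thesis using h by simp
qed

section \<open>Orthonormality and completeness\<close>

lemma zero_in_rational_circle: "0 \<in> rational_circle"
  unfolding rational_circle_def by (metis Rats_0 imageI to_circle_0)

lemma height_0: "height 0 = 1"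
  using height_eq[of 1 0] by (simp add: to_circle_0)

lemma height_pos: "\<beta> \<in> rational_circle \<Longrightarrow> 1 \<le> height \<beta>"
  by (metis height_eq rational_circleE)

lemma farey_fun_zero [simp]: "farey_fun 0 x = 1"
  by (simp add: farey_fun_def)

text \<open>Every jump of \<open>f\<^sub>\<beta>\<close> lies in the Farey set of order \<open>h(\<gamma>)\<close>, so \<open>f\<^sub>\<beta>\<close> is constant on the support
  of \<open>f\<^sub>\<gamma>\<close> unless \<open>\<beta> = \<gamma>\<close>.\<close>

lemma integral_farey_fun_product_le:
  assumes "\<gamma> \<in> rational_circle" "\<beta> \<in> rational_circle" "\<gamma> \<noteq> 0" "height \<beta> \<le> height \<gamma>"
  shows "(LINT x|unit_lebesgue. farey_fun \<gamma> (to_circle x) * farey_fun \<beta> (to_circle x)) =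
    (if \<gamma> = \<beta> then 1 else 0)"
proof (cases "\<beta> = 0")
  case True
  \<comment> \<open>On the unit interval the constant 1 is the step at 1, and
    \<open>to_circle 1 = 0\<close> differs from \<open>\<gamma>\<close>.\<close>
  have "(LINT x|unit_lebesgue. farey_fun \<gamma> (to_circle x) * farey_fun \<beta> (to_circle x)) =
      (LINT x|unit_lebesgue. farey_fun \<gamma> (to_circle x) * indicator {..<1} x)"
    using True by (intro Bochner_Integration.integral_cong) (auto simp: space_restrict_space)
  also have "\<dots> = 0"
    using assms(1,3) height_pos[OF assms(1)] zero_in_rational_circle
    by (subst integral_farey_fun_indicator) (auto simp: to_circle_1 farey_def height_0)
  finally show ?thesis using True assms by simp
next
  case False
  obtain p r :: nat and b l u :: real where
    h: "height \<beta> = p + r" and pr: "1 \<le> p" "1 \<le> r" and b: "\<beta> = to_circle b"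
    and l: "to_circle l \<in> rational_circle" "height (to_circle l) = p"
    and u: "to_circle u \<in> rational_circle" "height (to_circle u) = r"
    and ord: "0 \<le> l" "l < b" "b < u" "u \<le> 1"
    and "(real p + real r) * b = real p * l + real r * u"
    and "real p * (b - l) = 1 / (real p + real r)"
    and "\<forall>c. to_circle c \<in> farey (height \<beta>) \<longrightarrow> c \<le> l \<or> c = b \<or> u \<le> c"
    and step: "AE x in unit_lebesgue. farey_fun \<beta> (to_circle x) =
       (real p + real r) * indicator {..<b} x - real p * indicator {..<l} x - real r * indicator {..<u} x"
    using farey_fun_cases[OF assms(2) False] .
  let ?f = "\<lambda>x. farey_fun \<gamma> (to_circle x)"
  have meas: "?f \<in> borel_measurable unit_lebesgue"
    by (rule to_circle_unit_measurable) measurable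
  obtain B where B: "\<And>x. \<bar>farey_fun \<gamma> x\<bar> \<le> B" using farey_fun_bounded by blast
  have int: "integrable unit_lebesgue (\<lambda>x. ?f x * indicator {..<c} x)" for c
  proof (rule finite_measure.integrable_const_bound[OF finite_measure_unit_lebesgue])
    have "\<bar>farey_fun \<gamma> x * indicator A y\<bar> \<le> B" for x y and A :: "real set"
      using B[of x] by (auto simp: indicator_def)
    then show "AE x in unit_lebesgue. norm (?f x * indicator {..<c} x) \<le> B" by simp
    show "(\<lambda>x. ?f x * indicator {..<c} x) \<in> borel_measurable unit_lebesgue"
      by (intro borel_measurable_times meas borel_measurable_integrable[OF integrable_unit_indicator])
  qed
  have sum: "(LINT x|unit_lebesgue. ?f x * farey_fun \<beta> (to_circle x)) =
      (LINT x|unit_lebesgue. (real p + real r) * (?f x * indicator {..<b} x)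
        - real p * (?f x * indicator {..<l} x) - real r * (?f x * indicator {..<u} x))"
  proof (rule integral_cong_AE)
    show "(\<lambda>x. ?f x * farey_fun \<beta> (to_circle x)) \<in> borel_measurable unit_lebesgue"
      by (intro borel_measurable_times to_circle_unit_measurable farey_fun_measurable)
    show "(\<lambda>x. (real p + real r) * (?f x * indicator {..<b} x)
        - real p * (?f x * indicator {..<l} x) - real r * (?f x * indicator {..<u} x))
        \<in> borel_measurable unit_lebesgue"
      using int[THEN borel_measurable_integrable] by measurable
    show "AE x in unit_lebesgue. ?f x * farey_fun \<beta> (to_circle x) =
        (real p + real r) * (?f x * indicator {..<b} x)
        - real p * (?f x * indicator {..<l} x) - real r * (?f x * indicator {..<u} x)"
      using step
    proof eventually_elim
      case (elim x)
      show ?case unfolding elim by (simp add: algebra_simps)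
    qed
  qed
  have farey: "to_circle b \<in> farey (height \<gamma>)" "to_circle l \<in> farey (height \<gamma>)"
      "to_circle u \<in> farey (height \<gamma>)"
    using assms(2,4) b l u h by (auto simp: farey_def)
  \<comment> \<open>The neighbours of \<open>\<beta>\<close> have heights \<open>p\<close> and
    \<open>r\<close>, both smaller than \<open>p + r \<le> height \<gamma>\<close>. Hence only the
    step at \<open>b\<close> can contribute.\<close>
  have "to_circle l \<noteq> \<gamma>" "to_circle u \<noteq> \<gamma>"
    using assms(4) h l u pr by auto
  then have "(LINT x|unit_lebesgue. ?f x * indicator {..<l} x) = 0"
       "(LINT x|unit_lebesgue. ?f x * indicator {..<u} x) = 0"
    using integral_farey_fun_indicator[OF assms(1,3) _ _ farey(2)]
      integral_farey_fun_indicator[OF assms(1,3) _ _ farey(3)] ord by auto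
  moreover have "(LINT x|unit_lebesgue. ?f x * indicator {..<b} x) =
      (if \<beta> = \<gamma> then 1 / real (height \<gamma>) else 0)"
    using integral_farey_fun_indicator[OF assms(1,3) _ _ farey(1)] ord b by auto
  ultimately have "(LINT x|unit_lebesgue. ?f x * farey_fun \<beta> (to_circle x)) =
      (real p + real r) * (if \<beta> = \<gamma> then 1 / real (height \<gamma>) else 0)"
    unfolding sum by (simp add: int)
  then show ?thesis using h pr by auto
qed

lemma integral_farey_fun_product:
  assumes "\<gamma> \<in> rational_circle" "\<beta> \<in> rational_circle"
  shows "(LINT x|unit_lebesgue. farey_fun \<gamma> (to_circle x) * farey_fun \<beta> (to_circle x)) =
    (if \<gamma> = \<beta> then 1 else 0)"
proof -
  \<comment> \<open>The cases are exhaustive because \<open>height 0 = 1\<close> is the least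
    height: a point of strictly larger height is nonzero.\<close>
  consider "\<gamma> = 0" "\<beta> = 0" | "\<gamma> \<noteq> 0" "height \<beta> \<le> height \<gamma>" | "\<beta> \<noteq> 0" "height \<gamma> \<le> height \<beta>"
    using height_pos assms height_0 by (metis linear)
  then show ?thesis
  proof cases
    case 1
    then show ?thesis
      by (simp add: measure_restrict_space space_restrict_space)
  next
    case 2
    then show ?thesis using integral_farey_fun_product_le assms by blast
  next
    case 3
    then show ?thesis
      using integral_farey_fun_product_le[OF assms(2,1)]
      by (subst mult.commute) (simp add: eq_commute[of \<gamma>])
  qed
qed

lemma farey_fun_orthonormal:
  "L2_orthonormal haar_circle rational_circle (\<lambda>\<beta> x. complex_of_real (farey_fun \<beta> x))"
  unfolding L2_orthonormal_def
proof (intro conjI ballI)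
  show "(\<lambda>x. complex_of_real (farey_fun \<beta> x)) \<in> L2 haar_circle" for \<beta>
    by (subst L2_haar_circle_iff) (auto intro: farey_fun_L2)
next
  fix \<gamma> \<beta> assume "\<gamma> \<in> rational_circle" "\<beta> \<in> rational_circle"
  then have "complex_of_real (LINT x|unit_lebesgue. farey_fun \<gamma> (to_circle x) * farey_fun \<beta> (to_circle x)) =
    (if \<gamma> = \<beta> then 1 else 0)"
    by (simp add: integral_farey_fun_product)
  then show "L2_inner haar_circle (\<lambda>x. complex_of_real (farey_fun \<gamma> x))
      (\<lambda>x. complex_of_real (farey_fun \<beta> x)) = (if \<gamma> = \<beta> then 1 else 0)"
    unfolding L2_inner_def by (subst integral_haar_circle) (auto simp flip: of_real_mult)
qed

section \<open>Density of the span\<close>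

abbreviation farey_family :: "circle \<Rightarrow> real \<Rightarrow> complex" where
  "farey_family \<beta> x \<equiv> complex_of_real (farey_fun \<beta> (to_circle x))"

interpretation farey: L2_family unit_lebesgue rational_circle farey_family
  by standard (rule farey_fun_L2)

abbreviation farey_closed_span :: "(real \<Rightarrow> complex) set" where
  "farey_closed_span \<equiv> L2_closed_span unit_lebesgue rational_circle farey_family"

lemma indicator_unit_measurable [measurable]:
  "A \<in> sets borel \<Longrightarrow> (indicator A :: real \<Rightarrow> complex) \<in> borel_measurable unit_lebesgue"
  by (intro measurable_restrict_space1) simp

lemma closed_span_indicator_trivial:
  "c \<le> 0 \<Longrightarrow> indicator {..<c} \<in> farey_closed_span"
  "1 \<le> c \<Longrightarrow> indicator {..<c} \<in> farey_closed_span"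
proof -
  show "indicator {..<c} \<in> farey_closed_span" if "c \<le> 0"
    using that by (intro farey.closed_span_AE_cong[OF farey.closed_span_zero] AE_I2)
      (auto simp: space_restrict_space)
  show "indicator {..<c} \<in> farey_closed_span" if "1 \<le> c"
    using that by (intro farey.closed_span_AE_cong[OF farey.closed_span_member[OF zero_in_rational_circle]] AE_I2)
      (auto simp: space_restrict_space)
qed

text \<open>Up to null sets, \<open>f\<^sub>\<beta>\<close> expresses the step at \<open>\<beta>\<close> through itself and the steps at the two
  neighbours, whose heights are smaller.\<close>

lemma closed_span_indicator_rational:
  assumes "to_circle c \<in> rational_circle" "0 \<le> c" "c \<le> 1"
  shows "indicator {..<c} \<in> farey_closed_span"
  using assms
proof (induction "height (to_circle c)" arbitrary: c rule: less_induct)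
  case less
  show ?case
  \<comment> \<open>Neighbours may be represented by \<open>l = 0\<close> or \<open>u = 1\<close>,
    so both representatives of the point 0 end the recursion.\<close>
  proof (cases "c = 0 \<or> c = 1")
    case True
    then show ?thesis using closed_span_indicator_trivial[of c] by auto
  next
    case False
    have "to_circle c \<noteq> 0"
      using False less.prems to_circle_inj[of c 0] by (auto simp: to_circle_0)
    obtain p r :: nat and b l u :: real where
      h: "height (to_circle c) = p + r" and pr: "1 \<le> p" "1 \<le> r" and b: "to_circle c = to_circle b"
      and l: "to_circle l \<in> rational_circle" "height (to_circle l) = p"
      and u: "to_circle u \<in> rational_circle" "height (to_circle u) = r"
      and ord: "0 \<le> l" "l < b" "b < u" "u \<le> 1"
      and "(real p + real r) * b = real p * l + real r * u"
      and "real p * (b - l) = 1 / (real p + real r)"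
      and "\<forall>x. to_circle x \<in> farey (height (to_circle c)) \<longrightarrow> x \<le> l \<or> x = b \<or> u \<le> x"
      and step: "AE x in unit_lebesgue. farey_fun (to_circle c) (to_circle x) =
         (real p + real r) * indicator {..<b} x - real p * indicator {..<l} x - real r * indicator {..<u} x"
      using farey_fun_cases[OF less.prems(1) \<open>to_circle c \<noteq> 0\<close>] .
    have "c = b" using b ord less.prems by (intro to_circle_inj) auto
    have "indicator {..<l} \<in> farey_closed_span" "indicator {..<u} \<in> farey_closed_span"
      using less.hyps[of l] less.hyps[of u] h pr l u ord by auto
    then have "(\<lambda>x. (1 / of_nat (p + r)) * (farey_family (to_circle c) x
        + (of_nat p * indicator {..<l} x + of_nat r * indicator {..<u} x))) \<in> farey_closed_span"
      using less.prems(1)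
      by (intro farey.closed_span_add farey.closed_span_scale farey.closed_span_member)
    then show ?thesis
    proof (rule farey.closed_span_AE_cong)
      show "AE x in unit_lebesgue. (1 / of_nat (p + r)) * (farey_family (to_circle c) x
        + (of_nat p * indicator {..<l} x + of_nat r * indicator {..<u} x)) = indicator {..<c} x"
        using step
      proof eventually_elim
        case (elim x)
        have "of_nat p + of_nat r \<noteq> (0 :: complex)"
          using pr by (metis of_nat_add of_nat_eq_0_iff add_is_0 not_one_le_zero)
        moreover have "farey_family (to_circle c) x = complex_of_real ((real p + real r) * indicator {..<c} x
            - real p * indicator {..<l} x - real r * indicator {..<u} x)"
          using elim \<open>c = b\<close> by simp
        ultimately show ?case by (auto simp: indicator_def field_simps)
      qed
    qed measurable
  qed
qed

text \<open>Rationals \<open>c n < a\<close> tending to \<open>a\<close> give convergence at every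
  \<open>x\<close>: a point below \<open>a\<close> is eventually below \<open>c n\<close>, and a
  point at or above \<open>a\<close> never is.\<close>

lemma closed_span_indicator_lessThan: "indicator {..<a} \<in> farey_closed_span"
proof -
  have rational: "indicator {..<c} \<in> farey_closed_span" if "c \<in> \<rat>" for c
  proof -
    have "to_circle c \<in> rational_circle" using that by (simp add: rational_circle_def)
    then show ?thesis
      using closed_span_indicator_rational[of c] closed_span_indicator_trivial[of c] by linarith
  qed
  have "\<exists>c\<in>\<rat>. a - 1 / real (Suc n) < c \<and> c < a" for n
    by (rule Rats_dense_in_real) simp
  then obtain c where c: "\<And>n. c n \<in> \<rat>" "\<And>n. a - 1 / real (Suc n) < c n" "\<And>n. c n < a"
    by metis
  have "c \<longlonglongrightarrow> a"
  proof (rule tendsto_sandwich[of "\<lambda>n. a - 1 / real (Suc n)" c sequentially "\<lambda>_. a"])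
    show "(\<lambda>n. a - 1 / real (Suc n)) \<longlonglongrightarrow> a"
      using tendsto_diff[OF tendsto_const LIMSEQ_inverse_real_of_nat, of a]
      by (simp add: inverse_eq_divide)
  qed (use c in \<open>auto intro!: less_imp_le always_eventually\<close>)
  show ?thesis
  proof (rule farey.closed_span_dominated_limit[where w = "\<lambda>_. 1"])
    show "indicator {..<c n} \<in> farey_closed_span" for n
      by (rule rational[OF c(1)])
    show "AE x in unit_lebesgue. (\<lambda>n. indicator {..<c n} x) \<longlonglongrightarrow> (indicator {..<a} x :: complex)"
    proof (rule AE_I2)
      fix x
      show "(\<lambda>n. indicator {..<c n} x) \<longlonglongrightarrow> (indicator {..<a} x :: complex)"
      proof (cases "x < a")
        case True
        then have "eventually (\<lambda>n. indicator {..<c n} x = (indicator {..<a} x :: complex)) sequentially"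
          using order_tendstoD(1)[OF \<open>c \<longlonglongrightarrow> a\<close>, of x] by (auto elim!: eventually_mono)
        then show ?thesis by (rule tendsto_eventually)
      next
        case False
        then have "\<not> x < c n" for n using c(3)[of n] by simp
        then show ?thesis using False by simp
      qed
    qed
    show "integrable unit_lebesgue (\<lambda>_. 1\<^sup>2 :: real)"
      by (intro finite_measure.integrable_const finite_measure_unit_lebesgue)
  qed (auto simp: indicator_def)
qed

text \<open>The rays \<open>{..<a}\<close> generate the Borel sets and are closed under
  intersection, so it suffices to treat complements, where \<open>farey_fun 0\<close> supplies the
  constant 1, and disjoint unions.\<close>

lemma closed_span_indicator_borel:
  fixes A :: "real set"
  assumes "A \<in> sets borel"
  shows "indicator A \<in> farey_closed_span"
proof -
  have gen: "sets borel = sigma_sets UNIV (range (\<lambda>a::real. {..<a}))"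
    by (subst borel_Iio) simp
  have stable: "Int_stable (range (\<lambda>a::real. {..<a}))"
  proof (rule Int_stableI)
    fix X Y :: "real set" assume "X \<in> range (\<lambda>a. {..<a})" "Y \<in> range (\<lambda>a. {..<a})"
    then obtain a b where "X = {..<a}" "Y = {..<b}" by auto
    then have "X \<inter> Y = {..<min a b}" by auto
    then show "X \<inter> Y \<in> range (\<lambda>a. {..<a})" by blast
  qed
  have A: "A \<in> sigma_sets UNIV (range (\<lambda>a::real. {..<a}))" using assms gen by simp
  have sub: "range (\<lambda>a::real. {..<a}) \<subseteq> Pow UNIV" by simp
  from stable sub A show ?thesis
  proof (induction rule: sigma_sets_induct_disjoint)
    case (basic X)
    then show ?case using closed_span_indicator_lessThan by auto
  next
    case empty
    show ?case using farey.closed_span_zero by (simp add: indicator_def)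
  next
    case (compl X)
    have "(\<lambda>x. farey_family 0 x + (- 1) * indicator X x) \<in> farey_closed_span"
      by (intro farey.closed_span_add farey.closed_span_scale farey.closed_span_member
          zero_in_rational_circle compl.IH)
    moreover have "(\<lambda>x. farey_family 0 x + (- 1) * indicator X x) = indicator (UNIV - X)"
      by (auto simp: indicator_def fun_eq_iff)
    ultimately show ?case by simp
  next
    case (union X)
    have X: "X n \<in> sets borel" for n using union gen by auto
    \<comment> \<open>The sets \<open>X n\<close> live on the whole line, while the union lemma
      needs sets of \<open>unit_lebesgue\<close>; cutting down to \<open>{0..<1}\<close> changes
      nothing on the space.\<close>
    have "indicator (\<Union>n. X n \<inter> {0..<1}) \<in> farey_closed_span"
    proof (rule farey.closed_span_indicator_UN[OF finite_measure_unit_lebesgue])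
      show "disjoint_family (\<lambda>n. X n \<inter> {0..<1})"
        using union by (auto simp: disjoint_family_on_def)
      show "X n \<inter> {0..<1} \<in> sets unit_lebesgue" for n
        using X by (simp add: sets_restrict_space_iff)
      show "indicator (X n \<inter> {0..<1}) \<in> farey_closed_span" for n
        using X by (intro farey.closed_span_AE_cong[OF union.IH[of n]] indicator_unit_measurable AE_I2)
          (auto simp: space_restrict_space indicator_def)
    qed
    then show ?case
    proof (rule farey.closed_span_AE_cong)
      show "(indicator (\<Union>n. X n) :: real \<Rightarrow> complex) \<in> borel_measurable unit_lebesgue"
        using X by (intro indicator_unit_measurable sets.countable_UN) auto
    qed (auto intro!: AE_I2 simp: space_restrict_space indicator_def)
  qed
qed

lemma L2_subset_farey_closed_span:
  assumes "g \<in> L2 unit_lebesgue"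
  shows "g \<in> farey_closed_span"
proof (rule farey.closed_span_if_indicators[OF _ assms])
  fix A assume "A \<in> sets unit_lebesgue"
  then have "A \<in> sets borel" by (auto simp: sets_restrict_space)
  then show "indicator A \<in> farey_closed_span" by (rule closed_span_indicator_borel)
qed

theorem theorem4:
  "L2_orthonormal_basis haar_circle rational_circle (\<lambda>\<beta> x. complex_of_real (farey_fun \<beta> x))"
  unfolding L2_orthonormal_basis_def
proof (intro conjI ballI allI impI farey_fun_orthonormal)
  fix g :: "circle \<Rightarrow> complex" and \<epsilon> :: real
  assume g: "g \<in> L2 haar_circle" and "\<epsilon> > 0"
  have meas: "g \<in> borel_measurable borel" using L2_borel[OF g] by simp
  then have "(\<lambda>x. g (to_circle x)) \<in> farey_closed_span"
    using g by (intro L2_subset_farey_closed_span) (simp add: L2_haar_circle_iff)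
  \<comment> \<open>The closed span bounds squared norms, so the tolerance is squared here and the
    root is taken at the end.\<close>
  moreover have "\<epsilon>\<^sup>2 > 0" using \<open>\<epsilon> > 0\<close> by simp
  ultimately obtain F c where F: "finite F" "F \<subseteq> rational_circle"
    and Fc: "(LINT x|unit_lebesgue. (cmod (g (to_circle x) - (\<Sum>\<beta>\<in>F. c \<beta> * farey_family \<beta> x)))\<^sup>2) < \<epsilon>\<^sup>2"
    by (rule farey.closed_spanD)
  have "L2_norm haar_circle (\<lambda>x. g x - (\<Sum>\<beta>\<in>F. c \<beta> * complex_of_real (farey_fun \<beta> x)))
      = sqrt (LINT x|unit_lebesgue. (cmod (g (to_circle x) - (\<Sum>\<beta>\<in>F. c \<beta> * farey_family \<beta> x)))\<^sup>2)"
    unfolding L2_norm_def using meas by (subst integral_haar_circle) auto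
  also have "\<dots> < \<epsilon>"
    using Fc \<open>\<epsilon> > 0\<close> by (intro real_less_lsqrt) auto
  finally show "\<exists>F c. finite F \<and> F \<subseteq> rational_circle \<and>
      L2_norm haar_circle (\<lambda>x. g x - (\<Sum>\<beta>\<in>F. c \<beta> * complex_of_real (farey_fun \<beta> x))) < \<epsilon>"
    using F by blast
qed

end
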